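(* For all $n\ge 3$, there is a Nullstellensatz proof of infeasibility of the ordering principle system $\mathrm{ORD}_n$ on $n$ elements whose size and whose total coefficient size are both equal to $2^n-n$.
   Context: Ordering principle system $\mathrm{ORD}_n$: there is a Boolean variable $x_{i,j}$ for each $i,j\in[n]$ with $i<j$; for $i<j$ write $x_{j,i}=1-x_{i,j}$. The (non-Boolean) axioms are: for each $i\in[n]$, $\prod_{j\in[n]\setminus\{i\}}x_{i,j}=0$ (non-minimality axioms); and for each $i<j<k$ in $[n]$, $x_{i,j}x_{j,k}x_{k,i}=0$ and $x_{k,j}x_{j,i}x_{i,k}=0$ (transitivity axioms). Boolean Nullstellensatz proofs: given Boolean variables $y_1,\dots,y_N$, a monomial is a product $\prod_{a\in S}y_a\prod_{b\in T}(1-y_b)$ with $S,T\subseteq[N]$ disjoint. Given axioms $p_1=0,\dots,p_m=0$, a Nullstellensatz proof of infeasibility is a polynomial identity $1=\sum_{i=1}^m p_iq_i+\sum_{a=1}^N g_a(y_a^2-y_a)$ with polynomials $q_i,g_a$ with real coefficients, where each $q_i$ is given as a real linear combination $q_i=\sum_r c_{ir}r$ of monomials $r$ of the form $\prod_{a\in S}y_a\prod_{b\in T}(1-y_b)$ with $S,T\subseteq[N]$ disjoint. Its total coefficient size is $\sum_{i}\sum_r|c_{ir}|$ (the Boolean axioms are used for free), and its size is the number of pairs $(i,r)$ with $c_{ir}\ne 0$, i.e. the number of weakenings $r p_i$ of axioms used. *)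

theory Defs
  imports Complex_Main "HOL-Library.Poly_Mapping"
begin

text \<open>Multivariate polynomials with real coefficients, as finitely supported maps from exponent
  vectors to coefficients; the ring operations are those of HOL-Library's Poly_Mapping.\<close>

type_synonym 'v rpoly = "('v \<Rightarrow>\<^sub>0 nat) \<Rightarrow>\<^sub>0 real"

definition Const :: "real \<Rightarrow> 'v rpoly" where
  "Const c = Poly_Mapping.single 0 c"

definition Var :: "'v \<Rightarrow> 'v rpoly" where
  "Var v = Poly_Mapping.single (Poly_Mapping.single v 1) 1"

definition vars :: "'v rpoly \<Rightarrow> 'v set" where
  "vars p = (\<Union>m \<in> Poly_Mapping.keys p. Poly_Mapping.keys m)"

text \<open>A monomial \<open>\<Prod>\<^sub>S y\<^sub>a \<cdot> \<Prod>\<^sub>T (1 - y\<^sub>b)\<close> is encoded by the pair \<open>(S, T)\<close>; distinct pairs of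
  disjoint finite sets denote distinct polynomials.  A formal real linear combination of monomials is
  a finitely supported function on such pairs.\<close>

type_synonym 'v bmonom = "'v set \<times> 'v set"

definition bmonoms :: "'v set \<Rightarrow> 'v bmonom set" where
  "bmonoms V = {(S, T). S \<subseteq> V \<and> T \<subseteq> V \<and> S \<inter> T = {}}"

definition bmonom_poly :: "'v bmonom \<Rightarrow> 'v rpoly" where
  "bmonom_poly r = (\<Prod>a\<in>fst r. Var a) * (\<Prod>b\<in>snd r. 1 - Var b)"

definition comb_poly :: "('v bmonom \<Rightarrow>\<^sub>0 real) \<Rightarrow> 'v rpoly" where
  "comb_poly q =
    (\<Sum>r\<in>Poly_Mapping.keys q. Const (Poly_Mapping.lookup q r) * bmonom_poly r)"

text \<open>\<open>V\<close> is the set of Boolean variables, and \<open>p i = 0\<close> for \<open>i \<in> I\<close> are the axioms.\<close>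

definition nullstellensatz_proof ::
  "'v set \<Rightarrow> 'i set \<Rightarrow> ('i \<Rightarrow> 'v rpoly) \<Rightarrow>
   ('i \<Rightarrow> ('v bmonom \<Rightarrow>\<^sub>0 real)) \<Rightarrow> ('v \<Rightarrow> 'v rpoly) \<Rightarrow> bool" where
  "nullstellensatz_proof V I p q g \<longleftrightarrow>
     finite V \<and> finite I \<and>
     (\<forall>i\<in>I. Poly_Mapping.keys (q i) \<subseteq> bmonoms V) \<and>
     (\<forall>a\<in>V. vars (g a) \<subseteq> V) \<and>
     1 = (\<Sum>i\<in>I. p i * comb_poly (q i)) + (\<Sum>a\<in>V. g a * ((Var a)\<^sup>2 - Var a))"

definition ns_size :: "'i set \<Rightarrow> ('i \<Rightarrow> ('v bmonom \<Rightarrow>\<^sub>0 real)) \<Rightarrow> nat" where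
  "ns_size I q = card {(i, r). i \<in> I \<and> Poly_Mapping.lookup (q i) r \<noteq> 0}"

definition ns_coeff_size :: "'i set \<Rightarrow> ('i \<Rightarrow> ('v bmonom \<Rightarrow>\<^sub>0 real)) \<Rightarrow> real" where
  "ns_coeff_size I q =
    (\<Sum>i\<in>I. \<Sum>r\<in>Poly_Mapping.keys (q i). \<bar>Poly_Mapping.lookup (q i) r\<bar>)"

text \<open>The ordering principle on \<open>{1..n}\<close>; the variable \<open>x\<^sub>i\<^sub>j\<close> is indexed by the pair \<open>(i, j)\<close>
  with \<open>i < j\<close>.\<close>

definition ord_vars :: "nat \<Rightarrow> (nat \<times> nat) set" where
  "ord_vars n = {(i, j). 1 \<le> i \<and> i < j \<and> j \<le> n}"

definition ord_lit :: "nat \<Rightarrow> nat \<Rightarrow> (nat \<times> nat) rpoly" where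
  "ord_lit i j = (if i < j then Var (i, j) else 1 - Var (j, i))"

datatype ord_index = Nonmin nat | Trans_fwd nat nat nat | Trans_bwd nat nat nat

definition ord_indices :: "nat \<Rightarrow> ord_index set" where
  "ord_indices n =
     {Nonmin i | i. i \<in> {1..n}}
   \<union> {Trans_fwd i j k | i j k. 1 \<le> i \<and> i < j \<and> j < k \<and> k \<le> n}
   \<union> {Trans_bwd i j k | i j k. 1 \<le> i \<and> i < j \<and> j < k \<and> k \<le> n}"

fun ord_axiom :: "nat \<Rightarrow> ord_index \<Rightarrow> (nat \<times> nat) rpoly" where
  "ord_axiom n (Nonmin i) = (\<Prod>j\<in>{1..n} - {i}. ord_lit i j)"
| "ord_axiom n (Trans_fwd i j k) = ord_lit i j * ord_lit j k * ord_lit k i"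
| "ord_axiom n (Trans_bwd i j k) = ord_lit k j * ord_lit j i * ord_lit i k"

end

theory Submission
  imports Defs
begin

text \<open>Process the elements \<open>n, n - 1, \<dots>, 1\<close>, keeping a candidate \<open>c\<close> for the minimum, and let \<open>F A\<close> be
  the indicator that no element of \<open>A\<close> precedes all others.  Comparing two elements \<open>a, b \<notin> A\<close> gives
  \<open>F (A \<union> {a, b}) = x\<^sub>a\<^sub>b F (A \<union> {a}) + x\<^sub>b\<^sub>a F (A \<union> {b})\<close> up to one weakened
  transitivity axiom for each \<open>i \<in> A\<close> and each branch: if \<open>a\<close> precedes \<open>b\<close> and \<open>i\<close> is the minimum of
  \<open>A \<union> {a}\<close>, then \<open>i\<close> also precedes \<open>b\<close> unless \<open>i, a, b\<close> form a cycle.  The identity holds exactly, not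
  only modulo the Boolean axioms, and for \<open>n\<close> elements it uses \<open>f n\<close> weakenings with
  \<open>f (n + 1) = 2 f n + 2 (n - 1)\<close> and \<open>f 1 = 0\<close>, so \<open>f n = 2\<^sup>n - 2 n\<close>; the non-minimality axioms
  contribute \<open>n\<close> more.\<close>

section \<open>Source indicators and the comparison identity\<close>

lemma ord_lit_swap: "i \<noteq> j \<Longrightarrow> ord_lit j i = 1 - ord_lit i j"
  by (auto simp: ord_lit_def)

text \<open>For \<open>A = {1..n}\<close> and \<open>i\<close> in \<open>A\<close> this is the
  non-minimality axiom of \<open>i\<close>. The same formula also covers a new element compared with
  all of \<open>A\<close>.\<close>

definition source :: "nat set \<Rightarrow> nat \<Rightarrow> (nat \<times> nat) rpoly" where
  "source A i = (\<Prod>j\<in>A - {i}. ord_lit i j)"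

lemma source_insert:
  assumes "finite A" "a \<notin> A" "i \<noteq> a"
  shows "source (insert a A) i = ord_lit i a * source A i"
  using assms by (simp add: source_def insert_Diff_if)

lemma source_insert_self: "source (insert a A) a = source A a"
  by (simp add: source_def)

text \<open>On 0/1 assignments two distinct sources of \<open>A\<close> would contain complementary
  literals, so at most one product is 1 and the difference is an indicator.\<close>

definition sourceless :: "nat set \<Rightarrow> (nat \<times> nat) rpoly" where
  "sourceless A = 1 - (\<Sum>i\<in>A. source A i)"

text \<open>Expanding \<open>ord_lit b i = 1 - ord_lit i b\<close> in a cycle gives a term that
  cancels the source of \<open>i\<close> in \<open>insert a A\<close> and one in which
  \<open>i\<close> precedes both \<open>a\<close> and \<open>b\<close>. As
  \<open>ord_lit a b + ord_lit b a = 1\<close>, the two branches together produce the latter exactly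
  once.\<close>

lemma sourceless_insert2:
  assumes "finite A" "a \<notin> A" "b \<notin> A" "a \<noteq> b"
  shows "sourceless (insert a (insert b A)) =
    ord_lit a b * sourceless (insert a A) + ord_lit b a * sourceless (insert b A) +
    (\<Sum>i\<in>A. ord_lit i a * ord_lit a b * ord_lit b i * source A i) +
    (\<Sum>i\<in>A. ord_lit i b * ord_lit b a * ord_lit a i * source A i)"
proof -
  let ?x = "ord_lit a b"
  have ba: "ord_lit b a = 1 - ?x"
    using assms by (intro ord_lit_swap)
  have two: "(\<Sum>i\<in>A. source (insert a (insert b A)) i) =
      (\<Sum>i\<in>A. ord_lit i a * (ord_lit i b * source A i))"
  proof (intro sum.cong refl)
    fix i assume "i \<in> A"
    then have "i \<noteq> a" "i \<noteq> b"
      using assms by blast+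
    then show "source (insert a (insert b A)) i = ord_lit i a * (ord_lit i b * source A i)"
      using assms by (simp add: source_insert)
  qed
  have one: "sourceless (insert d A) = 1 - (source A d + (\<Sum>i\<in>A. ord_lit i d * source A i))"
    if "d \<notin> A" for d
  proof -
    have "(\<Sum>i\<in>A. source (insert d A) i) = (\<Sum>i\<in>A. ord_lit i d * source A i)"
      using assms that by (intro sum.cong refl source_insert) auto
    then show ?thesis
      using assms that by (simp add: sourceless_def source_insert_self)
  qed
  \<comment> \<open>Stated for general \<open>d\<close> and \<open>e\<close> because the branches
    use it as \<open>(a, b)\<close> and as \<open>(b, a)\<close>.\<close>
  have cycle: "(\<Sum>i\<in>A. ord_lit i d * ord_lit d e * ord_lit e i * source A i) =
      ord_lit d e * (\<Sum>i\<in>A. ord_lit i d * source A i)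
      - ord_lit d e * (\<Sum>i\<in>A. ord_lit i d * (ord_lit i e * source A i))"
    if "e \<notin> A" for d e
    unfolding sum_distrib_left sum_subtractf[symmetric]
  proof (intro sum.cong refl)
    fix i assume "i \<in> A"
    then have "i \<noteq> e"
      using that by blast
    then have swap: "ord_lit e i = 1 - ord_lit i e"
      by (rule ord_lit_swap)
    show "ord_lit i d * ord_lit d e * ord_lit e i * source A i =
        ord_lit d e * (ord_lit i d * source A i)
        - ord_lit d e * (ord_lit i d * (ord_lit i e * source A i))"
      unfolding swap by (simp add: algebra_simps)
  qed
  have comm: "(\<Sum>i\<in>A. ord_lit i b * (ord_lit i a * source A i)) =
      (\<Sum>i\<in>A. ord_lit i a * (ord_lit i b * source A i))"
    by (intro sum.cong refl mult.left_commute)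
  have "source (insert a (insert b A)) a = ?x * source A a"
    using assms by (simp add: source_insert_self source_insert)
  moreover have "source (insert a (insert b A)) b = ord_lit b a * source A b"
    using assms by (simp add: source_insert_self source_insert insert_commute[of a b])
  ultimately have "sourceless (insert a (insert b A)) =
      1 - (?x * source A a + (ord_lit b a * source A b +
        (\<Sum>i\<in>A. ord_lit i a * (ord_lit i b * source A i))))"
    using assms by (simp add: sourceless_def two)
  then show ?thesis
    unfolding cycle[OF assms(2)] cycle[OF assms(3)] one[OF assms(2)] one[OF assms(3)] comm
    unfolding ba by (simp add: algebra_simps)
qed

section \<open>Variables, axiom indices and monomials over a set of elements\<close>

text \<open>The recursion meets sets \<open>insert c {1..m}\<close>, in general not initial
  segments, so variables and indices are relativized to arbitrary sets.\<close>

definition up_pairs :: "nat set \<Rightarrow> (nat \<times> nat) set" where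
  "up_pairs A = {(i, j). i \<in> A \<and> j \<in> A \<and> i < j}"

definition transitivity_indices :: "nat set \<Rightarrow> ord_index set" where
  "transitivity_indices A =
     {Trans_fwd i j k | i j k. i \<in> A \<and> j \<in> A \<and> k \<in> A \<and> i < j \<and> j < k}
   \<union> {Trans_bwd i j k | i j k. i \<in> A \<and> j \<in> A \<and> k \<in> A \<and> i < j \<and> j < k}"

lemma up_pairs_mono: "A \<subseteq> B \<Longrightarrow> up_pairs A \<subseteq> up_pairs B"
  by (auto simp: up_pairs_def)

lemma transitivity_indices_mono:
  "A \<subseteq> B \<Longrightarrow> transitivity_indices A \<subseteq> transitivity_indices B"
  by (fastforce simp: transitivity_indices_def)

lemma bmonoms_mono: "V \<subseteq> W \<Longrightarrow> bmonoms V \<subseteq> bmonoms W"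
  by (auto simp: bmonoms_def)

lemma finite_up_pairs: "finite A \<Longrightarrow> finite (up_pairs A)"
  by (rule finite_subset[of _ "A \<times> A"]) (auto simp: up_pairs_def)

lemma up_pairs_atLeastAtMost: "up_pairs {1..n} = ord_vars n"
  by (auto simp: up_pairs_def ord_vars_def)

text \<open>Encodes \<open>source A i\<close> as a multiplier admissible in a proof:
  \<open>ord_lit i j\<close> is a plain variable for \<open>i < j\<close> and a negated one for
  \<open>j < i\<close>.\<close>

definition source_bmonom :: "nat set \<Rightarrow> nat \<Rightarrow> (nat \<times> nat) bmonom" where
  "source_bmonom A i = ((\<lambda>j. (i, j)) ` {j \<in> A. i < j}, (\<lambda>j. (j, i)) ` {j \<in> A. j < i})"

lemma source_bmonom_in_bmonoms: "i \<in> A \<Longrightarrow> source_bmonom A i \<in> bmonoms (up_pairs A)"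
  by (auto simp: source_bmonom_def bmonoms_def up_pairs_def)

lemma bmonom_poly_source_bmonom:
  assumes "finite A"
  shows "bmonom_poly (source_bmonom A i) = source A i"
proof -
  have "A - {i} = {j \<in> A. i < j} \<union> {j \<in> A. j < i}"
    by auto
  then have "source A i =
      (\<Prod>j\<in>{j \<in> A. i < j}. ord_lit i j) * (\<Prod>j\<in>{j \<in> A. j < i}. ord_lit i j)"
    unfolding source_def using assms by (simp add: prod.union_disjoint disjoint_iff)
  also have "(\<Prod>j\<in>{j \<in> A. i < j}. ord_lit i j) = (\<Prod>j\<in>{j \<in> A. i < j}. Var (i, j))"
    by (intro prod.cong) (auto simp: ord_lit_def)
  also have "(\<Prod>j\<in>{j \<in> A. j < i}. ord_lit i j) = (\<Prod>j\<in>{j \<in> A. j < i}. 1 - Var (j, i))"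
    by (intro prod.cong) (auto simp: ord_lit_def)
  finally show ?thesis
    by (simp add: bmonom_poly_def source_bmonom_def prod.reindex inj_on_def)
qed

text \<open>Like \<open>add_neg\<close>, meant as multiplication of a weakening by one literal. As
  \<open>insert\<close> is idempotent, this is right only for a variable absent from that set;
  disjointness requires it to be absent from the other set as well.\<close>

definition add_pos :: "'v \<Rightarrow> 'i \<times> 'v bmonom \<Rightarrow> 'i \<times> 'v bmonom" where
  "add_pos v = (\<lambda>(t, S, U). (t, insert v S, U))"

definition add_neg :: "'v \<Rightarrow> 'i \<times> 'v bmonom \<Rightarrow> 'i \<times> 'v bmonom" where
  "add_neg v = (\<lambda>(t, S, U). (t, S, insert v U))"

lemma add_pos_subset:
  assumes "W \<subseteq> I \<times> bmonoms V" "v \<notin> V" "I \<subseteq> J" "insert v V \<subseteq> V'"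
  shows "add_pos v ` W \<subseteq> J \<times> bmonoms V'"
proof (rule image_subsetI)
  fix w assume "w \<in> W"
  then have "w \<in> J \<times> bmonoms V"
    using assms(1,3) by blast
  then obtain t S U where "w = (t, S, U)" "t \<in> J" "S \<subseteq> V" "U \<subseteq> V" "S \<inter> U = {}"
    by (auto simp: bmonoms_def)
  then show "add_pos v w \<in> J \<times> bmonoms V'"
    using assms(2,4) by (auto simp: add_pos_def bmonoms_def)
qed

lemma add_neg_subset:
  assumes "W \<subseteq> I \<times> bmonoms V" "v \<notin> V" "I \<subseteq> J" "insert v V \<subseteq> V'"
  shows "add_neg v ` W \<subseteq> J \<times> bmonoms V'"
proof (rule image_subsetI)
  fix w assume "w \<in> W"
  then have "w \<in> J \<times> bmonoms V"
    using assms(1,3) by blast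
  then obtain t S U where "w = (t, S, U)" "t \<in> J" "S \<subseteq> V" "U \<subseteq> V" "S \<inter> U = {}"
    by (auto simp: bmonoms_def)
  then show "add_neg v w \<in> J \<times> bmonoms V'"
    using assms(2,4) by (auto simp: add_neg_def bmonoms_def)
qed

text \<open>The weakened transitivity axioms for the elements \<open>1, \<dots>, m\<close> and the candidate \<open>c > m\<close>.\<close>

fun weakenings :: "nat \<Rightarrow> nat \<Rightarrow> (ord_index \<times> (nat \<times> nat) bmonom) set" where
  "weakenings 0 c = {}"
| "weakenings (Suc m) c =
     add_neg (Suc m, c) ` weakenings m c
   \<union> add_pos (Suc m, c) ` weakenings m (Suc m)
   \<union> ((\<lambda>i. (Trans_bwd i (Suc m) c, source_bmonom {1..m} i)) ` {1..m}
   \<union> (\<lambda>i. (Trans_fwd i (Suc m) c, source_bmonom {1..m} i)) ` {1..m})"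

lemma weakenings_subset:
  "m < c \<Longrightarrow> weakenings m c \<subseteq>
    transitivity_indices (insert c {1..m}) \<times> bmonoms (up_pairs (insert c {1..m}))"
proof (induction m arbitrary: c)
  case (Suc m)
  let ?A = "insert c {1..Suc m}"
  \<comment> \<open>Each recursive call adds one of \<open>c\<close> and \<open>Suc m\<close> to
    \<open>{1..m}\<close>, never both, so neither can mention the variable comparing them.\<close>
  have sub: "insert d {1..m} \<subseteq> ?A" and fresh: "(Suc m, c) \<notin> up_pairs (insert d {1..m})"
    and new: "insert (Suc m, c) (up_pairs (insert d {1..m})) \<subseteq> up_pairs ?A"
    if "d = c \<or> d = Suc m" for d
    using that Suc.prems by (auto simp: up_pairs_def)
  note add = transitivity_indices_mono[OF sub] new fresh
  have "add_neg (Suc m, c) ` weakenings m c \<subseteq> transitivity_indices ?A \<times> bmonoms (up_pairs ?A)"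
    by (rule add_neg_subset[OF Suc.IH]) (use Suc.prems add[of c] in simp_all)
  moreover have "add_pos (Suc m, c) ` weakenings m (Suc m)
      \<subseteq> transitivity_indices ?A \<times> bmonoms (up_pairs ?A)"
    by (rule add_pos_subset[OF Suc.IH]) (use add[of "Suc m"] in simp_all)
  moreover have "source_bmonom {1..m} i \<in> bmonoms (up_pairs ?A)" if "i \<in> {1..m}" for i
    by (rule subsetD[OF bmonoms_mono[OF up_pairs_mono] source_bmonom_in_bmonoms[OF that]]) auto
  moreover have "Trans_bwd i (Suc m) c \<in> transitivity_indices ?A"
      "Trans_fwd i (Suc m) c \<in> transitivity_indices ?A" if "i \<in> {1..m}" for i
    using that Suc.prems by (auto simp: transitivity_indices_def)
  ultimately show ?case
    by auto
qed simp

lemma weakenings_memberD: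
  assumes "(t, S, U) \<in> weakenings m c" "m < c"
  shows "t \<in> transitivity_indices (insert c {1..m})"
    and "S \<subseteq> up_pairs (insert c {1..m})" "U \<subseteq> up_pairs (insert c {1..m})"
    and "finite S" "finite U"
proof -
  show "t \<in> transitivity_indices (insert c {1..m})"
    and "S \<subseteq> up_pairs (insert c {1..m})" "U \<subseteq> up_pairs (insert c {1..m})"
    using subsetD[OF weakenings_subset[OF assms(2)] assms(1)] by (simp_all add: bmonoms_def)
  then show "finite S" "finite U"
    by (auto intro: finite_subset[OF _ finite_up_pairs])
qed

text \<open>This makes attaching a literal of \<open>(Suc m, c)\<close> both injective and a genuine
  multiplication.\<close>

lemma weakenings_fresh:
  assumes "(t, S, U) \<in> weakenings m d" "d = c \<or> d = Suc m" "Suc m < c"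
  shows "(Suc m, c) \<notin> S" "(Suc m, c) \<notin> U"
proof -
  have "m < d" and "(Suc m, c) \<notin> up_pairs (insert d {1..m})"
    using assms(2,3) by (auto simp: up_pairs_def)
  then show "(Suc m, c) \<notin> S" "(Suc m, c) \<notin> U"
    using weakenings_memberD(2,3)[OF assms(1)] by auto
qed

lemma finite_weakenings: "finite (weakenings m c)"
  by (induction m arbitrary: c) auto

section \<open>Sums over the weakenings and their number\<close>

declare weakenings.simps(2) [simp del]

lemma inj_on_add_neg: "(\<And>t S U. (t, S, U) \<in> W \<Longrightarrow> v \<notin> U) \<Longrightarrow> inj_on (add_neg v) W"
  by (rule inj_onI) (auto simp: add_neg_def insert_ident split: prod.splits)

lemma inj_on_add_pos: "(\<And>t S U. (t, S, U) \<in> W \<Longrightarrow> v \<notin> S) \<Longrightarrow> inj_on (add_pos v) W"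
  by (rule inj_onI) (auto simp: add_pos_def insert_ident split: prod.splits)

text \<open>Left general in \<open>h\<close> so that one decomposition serves both the count
  (\<open>h\<close> constantly 1) and the polynomial sum.\<close>

lemma sum_weakenings_Suc:
  assumes "Suc m < c"
  shows "sum h (weakenings (Suc m) c) =
    (\<Sum>w\<in>weakenings m c. h (add_neg (Suc m, c) w)) +
    (\<Sum>w\<in>weakenings m (Suc m). h (add_pos (Suc m, c) w)) +
    ((\<Sum>i\<in>{1..m}. h (Trans_bwd i (Suc m) c, source_bmonom {1..m} i)) +
     (\<Sum>i\<in>{1..m}. h (Trans_fwd i (Suc m) c, source_bmonom {1..m} i)))"
proof -
  let ?v = "(Suc m, c)"
  let ?N = "add_neg ?v ` weakenings m c" and ?P = "add_pos ?v ` weakenings m (Suc m)"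
  let ?B = "(\<lambda>i. (Trans_bwd i (Suc m) c, source_bmonom {1..m} i)) ` {1..m}"
  let ?F = "(\<lambda>i. (Trans_fwd i (Suc m) c, source_bmonom {1..m} i)) ` {1..m}"
  note fresh = weakenings_fresh[OF _ _ assms]
  \<comment> \<open>The sign of \<open>?v\<close> separates the branches: it is negated throughout
    \<open>?N\<close> and never in \<open>?P\<close>.\<close>
  have "?v \<in> snd (snd w)" if "w \<in> ?N" for w
    using that by (auto simp: add_neg_def)
  moreover have "?v \<notin> snd (snd w)" if "w \<in> ?P" for w
    using that fresh(2)[of _ _ _ "Suc m"] by (auto simp: add_pos_def)
  ultimately have "?N \<inter> ?P = {}"
    by blast
  moreover have "fst w \<in> transitivity_indices (insert c {1..m}) \<union>
      transitivity_indices (insert (Suc m) {1..m})" if "w \<in> ?N \<union> ?P" for w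
    using that assms by (auto simp: add_neg_def add_pos_def dest: weakenings_memberD(1))
  \<comment> \<open>A new index contains both \<open>Suc m\<close> and \<open>c\<close>, which no
    index from either branch does.\<close>
  moreover have "fst w \<notin> transitivity_indices (insert c {1..m}) \<union>
      transitivity_indices (insert (Suc m) {1..m})" if "w \<in> ?B \<union> ?F" for w
    using that assms by (auto simp: transitivity_indices_def)
  moreover have "?B \<inter> ?F = {}"
    by auto
  ultimately have disj: "?N \<inter> ?P = {}" "(?N \<union> ?P) \<inter> (?B \<union> ?F) = {}" "?B \<inter> ?F = {}"
    by blast+
  have split: "sum h (N \<union> P \<union> (B \<union> F)) = sum h N + sum h P + (sum h B + sum h F)"
    if "finite N" "finite P" "finite B" "finite F"
      "N \<inter> P = {}" "(N \<union> P) \<inter> (B \<union> F) = {}" "B \<inter> F = {}" for N P B F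
    using that by (simp add: sum.union_disjoint)
  have "sum h (weakenings (Suc m) c) = sum h ?N + sum h ?P + (sum h ?B + sum h ?F)"
    unfolding weakenings.simps(2)
    by (rule split[OF _ _ _ _ disj]) (simp_all add: finite_weakenings)
  moreover have "inj_on (add_neg ?v) (weakenings m c)"
    by (rule inj_on_add_neg) (use fresh in blast)
  then have "sum h ?N = (\<Sum>w\<in>weakenings m c. h (add_neg ?v w))"
    by (rule sum.reindex[unfolded o_def])
  moreover have "inj_on (add_pos ?v) (weakenings m (Suc m))"
    by (rule inj_on_add_pos) (use fresh in blast)
  then have "sum h ?P = (\<Sum>w\<in>weakenings m (Suc m). h (add_pos ?v w))"
    by (rule sum.reindex[unfolded o_def])
  moreover have "sum h ?B = (\<Sum>i\<in>{1..m}. h (Trans_bwd i (Suc m) c, source_bmonom {1..m} i))"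
    "sum h ?F = (\<Sum>i\<in>{1..m}. h (Trans_fwd i (Suc m) c, source_bmonom {1..m} i))"
    by (simp_all add: sum.reindex inj_on_def)
  ultimately show ?thesis
    by (simp only:)
qed

text \<open>The branches contribute equally many, whatever the candidate, and \<open>2 * m\<close>
  cycles are new. The exponent is \<open>Suc m\<close> because the candidate counts too; the
  additive form avoids truncated subtraction.\<close>

lemma card_weakenings: "m < c \<Longrightarrow> card (weakenings m c) + 2 * Suc m = 2 ^ Suc m"
proof (induction m arbitrary: c)
  case (Suc m)
  have "card (weakenings (Suc m) c) =
      card (weakenings m c) + card (weakenings m (Suc m)) + 2 * m"
    using sum_weakenings_Suc[OF Suc.prems, of "\<lambda>_. 1 :: nat"] by simp
  moreover have "card (weakenings m c) + 2 * Suc m = 2 ^ Suc m"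
    "card (weakenings m (Suc m)) + 2 * Suc m = 2 ^ Suc m"
    using Suc.IH Suc.prems by simp_all
  ultimately show ?case
    by simp
qed simp

section \<open>The polynomial identity for the sum of the weakenings\<close>

definition weakened_axiom ::
  "nat \<Rightarrow> ord_index \<times> (nat \<times> nat) bmonom \<Rightarrow> (nat \<times> nat) rpoly" where
  "weakened_axiom n w = ord_axiom n (fst w) * bmonom_poly (snd w)"

lemma weakened_axiom_add_neg:
  assumes "finite U" "v \<notin> U"
  shows "weakened_axiom n (add_neg v (t, S, U)) = (1 - Var v) * weakened_axiom n (t, S, U)"
  using assms by (simp add: weakened_axiom_def add_neg_def bmonom_poly_def mult_ac)

lemma weakened_axiom_add_pos:
  assumes "finite S" "v \<notin> S"
  shows "weakened_axiom n (add_pos v (t, S, U)) = Var v * weakened_axiom n (t, S, U)"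
  using assms by (simp add: weakened_axiom_def add_pos_def bmonom_poly_def mult_ac)

text \<open>Unrolls the comparison identity along the recursion; \<open>c\<close> is generalized
  because one branch replaces it by \<open>Suc m\<close>.\<close>

lemma sum_weakenings_eq_sourceless:
  "m < c \<Longrightarrow> (\<Sum>w\<in>weakenings m c. weakened_axiom n w) = sourceless (insert c {1..m})"
proof (induction m arbitrary: c)
  case 0
  \<comment> \<open>A single element is its own source, by the empty product, so both sides are
    0.\<close>
  then show ?case
    by (simp add: sourceless_def source_def)
next
  case (Suc m)
  let ?v = "(Suc m, c)"
  have bounds: "finite S \<and> finite U \<and> ?v \<notin> S \<and> ?v \<notin> U"
    if "(t, S, U) \<in> weakenings m d" "d = c \<or> d = Suc m" for t S U d
    using weakenings_memberD(4,5)[OF that(1)] weakenings_fresh[OF that] that(2) Suc.prems by auto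
  \<comment> \<open>In this branch \<open>c\<close> precedes \<open>Suc m\<close>; since
    \<open>Suc m < c\<close>, that literal is \<open>1 - Var (Suc m, c)\<close>.\<close>
  have "(\<Sum>w\<in>weakenings m c. weakened_axiom n (add_neg ?v w)) =
      (\<Sum>w\<in>weakenings m c. ord_lit c (Suc m) * weakened_axiom n w)"
  proof (intro sum.cong refl)
    fix w assume "w \<in> weakenings m c"
    then show "weakened_axiom n (add_neg ?v w) = ord_lit c (Suc m) * weakened_axiom n w"
      using bounds Suc.prems by (cases w) (simp add: weakened_axiom_add_neg ord_lit_def)
  qed
  also have "\<dots> = ord_lit c (Suc m) * sourceless (insert c {1..m})"
    using Suc by (simp flip: sum_distrib_left)
  finally have neg: "(\<Sum>w\<in>weakenings m c. weakened_axiom n (add_neg ?v w)) =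
      ord_lit c (Suc m) * sourceless (insert c {1..m})" .
  have "(\<Sum>w\<in>weakenings m (Suc m). weakened_axiom n (add_pos ?v w)) =
      (\<Sum>w\<in>weakenings m (Suc m). ord_lit (Suc m) c * weakened_axiom n w)"
  proof (intro sum.cong refl)
    fix w assume "w \<in> weakenings m (Suc m)"
    then show "weakened_axiom n (add_pos ?v w) = ord_lit (Suc m) c * weakened_axiom n w"
      using bounds Suc.prems by (cases w) (simp add: weakened_axiom_add_pos ord_lit_def)
  qed
  also have "\<dots> = ord_lit (Suc m) c * sourceless (insert (Suc m) {1..m})"
    using Suc by (simp flip: sum_distrib_left)
  finally have pos: "(\<Sum>w\<in>weakenings m (Suc m). weakened_axiom n (add_pos ?v w)) =
      ord_lit (Suc m) c * sourceless (insert (Suc m) {1..m})" .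
  have "insert c {1..Suc m} = insert c (insert (Suc m) {1..m})"
    by auto
  \<comment> \<open>The comparison identity with \<open>a = c\<close> and \<open>b = Suc m\<close>.
    Up to the order of factors, its cycles are the axioms \<open>Trans_bwd i (Suc m) c\<close> and
    \<open>Trans_fwd i (Suc m) c\<close>, respectively.\<close>
  then have "sourceless (insert c {1..Suc m}) =
      ord_lit c (Suc m) * sourceless (insert c {1..m}) +
      ord_lit (Suc m) c * sourceless (insert (Suc m) {1..m}) +
      (\<Sum>i\<in>{1..m}. ord_lit i c * ord_lit c (Suc m) * ord_lit (Suc m) i * source {1..m} i) +
      (\<Sum>i\<in>{1..m}. ord_lit i (Suc m) * ord_lit (Suc m) c * ord_lit c i * source {1..m} i)"
    using Suc.prems by (simp only:) (rule sourceless_insert2; simp)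
  then show ?case
    by (simp add: sum_weakenings_Suc[OF Suc.prems] neg pos
        weakened_axiom_def[where w = "(_, source_bmonom _ _)"] bmonom_poly_source_bmonom mult_ac)
qed

section \<open>From a set of weakenings to a formal proof\<close>

text \<open>With all coefficients 0 or 1, a finite set of index-monomial pairs determines the
  multipliers, and both size measures become its cardinality.\<close>

definition unit_coeffs :: "('i \<times> 'v bmonom) set \<Rightarrow> 'i \<Rightarrow> ('v bmonom \<Rightarrow>\<^sub>0 real)" where
  "unit_coeffs W i = (\<Sum>r\<in>W `` {i}. Poly_Mapping.single r 1)"

lemma lookup_unit_coeffs:
  assumes "finite W"
  shows "Poly_Mapping.lookup (unit_coeffs W i) r = (if (i, r) \<in> W then 1 else 0)"
proof -
  have "finite (W `` {i})"
    using assms by (rule finite_Image)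
  then show ?thesis
    by (simp add: unit_coeffs_def lookup_sum lookup_single when_def)
qed

lemma keys_unit_coeffs: "finite W \<Longrightarrow> Poly_Mapping.keys (unit_coeffs W i) = W `` {i}"
  by (auto simp: in_keys_iff lookup_unit_coeffs split: if_splits)

lemma sum_Image_singleton:
  assumes "finite W" "finite I" "fst ` W \<subseteq> I"
  shows "(\<Sum>i\<in>I. \<Sum>r\<in>W `` {i}. h i r) = (\<Sum>(i, r)\<in>W. h i r)"
proof -
  have "Sigma I (\<lambda>i. W `` {i}) = W"
    using assms(3) by force
  then show ?thesis
    using assms finite_Image[OF assms(1)] by (simp add: sum.Sigma)
qed

lemma Const_1: "Const 1 = 1"
  by (simp add: Const_def)

lemma sum_comb_poly_unit_coeffs:
  assumes "finite W" "finite I" "fst ` W \<subseteq> I"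
  shows "(\<Sum>i\<in>I. p i * comb_poly (unit_coeffs W i)) = (\<Sum>(i, r)\<in>W. p i * bmonom_poly r)"
proof -
  have "comb_poly (unit_coeffs W i) = (\<Sum>r\<in>W `` {i}. bmonom_poly r)" for i
    using assms(1) by (simp add: comb_poly_def keys_unit_coeffs lookup_unit_coeffs Const_1)
  then show ?thesis
    by (simp only: sum_distrib_left sum_Image_singleton[OF assms])
qed

lemma ns_size_unit_coeffs:
  assumes "finite W" "fst ` W \<subseteq> I"
  shows "ns_size I (unit_coeffs W) = card W"
proof -
  have "{(i, r). i \<in> I \<and> Poly_Mapping.lookup (unit_coeffs W i) r \<noteq> 0} = W"
    using assms by (force simp: lookup_unit_coeffs split: if_splits)
  then show ?thesis
    by (simp add: ns_size_def)
qed

lemma ns_coeff_size_unit_coeffs: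
  assumes "finite W" "finite I" "fst ` W \<subseteq> I"
  shows "ns_coeff_size I (unit_coeffs W) = real (card W)"
  using sum_Image_singleton[OF assms, of "\<lambda>_ _. 1 :: real"]
  by (simp add: ns_coeff_size_def keys_unit_coeffs lookup_unit_coeffs assms)

lemma finite_ord_indices: "finite (ord_indices n)"
proof -
  let ?T = "{1..n} \<times> {1..n} \<times> {1..n}"
  have "ord_indices n \<subseteq> Nonmin ` {1..n}
      \<union> ((\<lambda>(i, j, k). Trans_fwd i j k) ` ?T \<union> (\<lambda>(i, j, k). Trans_bwd i j k) ` ?T)"
    by (fastforce simp: ord_indices_def image_iff)
  then show ?thesis
    by (rule finite_subset) simp
qed

theorem theorem2:
  fixes n :: nat
  assumes "n \<ge> 3"
  shows "\<exists>q g. nullstellensatz_proof (ord_vars n) (ord_indices n) (ord_axiom n) q g \<and>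
           real (ns_size (ord_indices n) q) = 2 ^ n - real n \<and>
           ns_coeff_size (ord_indices n) q = 2 ^ n - real n"
proof -
  obtain m where n: "n = Suc m"
    using assms by (cases n) auto
  \<comment> \<open>Each non-minimality axiom is used once, weakened by the empty monomial 1; the
    transitivity part starts from the candidate \<open>n\<close>.\<close>
  define M :: "(ord_index \<times> (nat \<times> nat) bmonom) set"
    where "M = (\<lambda>i. (Nonmin i, {}, {})) ` {1..n}"
  define W where "W = M \<union> weakenings m n"
  have inj: "inj_on (\<lambda>i. (Nonmin i, {}, {})) {1..n}"
    by (auto simp: inj_on_def)
  have A: "insert n {1..m} = {1..n}"
    using n by auto
  have sub: "weakenings m n \<subseteq> transitivity_indices {1..n} \<times> bmonoms (ord_vars n)"
    using weakenings_subset[of m n] n unfolding A up_pairs_atLeastAtMost by simp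
  have disj: "M \<inter> weakenings m n = {}"
    using sub by (auto simp: M_def transitivity_indices_def)
  have fin: "finite M" "finite W"
    by (auto simp: M_def W_def finite_weakenings)
  have "transitivity_indices {1..n} \<subseteq> ord_indices n"
    by (auto simp: transitivity_indices_def ord_indices_def)
  with sub have "weakenings m n \<subseteq> ord_indices n \<times> bmonoms (ord_vars n)"
    by blast
  moreover have "M \<subseteq> ord_indices n \<times> bmonoms (ord_vars n)"
    by (auto simp: M_def ord_indices_def bmonoms_def)
  ultimately have W: "W \<subseteq> ord_indices n \<times> bmonoms (ord_vars n)"
    by (simp add: W_def)
  then have idx: "fst ` W \<subseteq> ord_indices n" and mon: "W `` {i} \<subseteq> bmonoms (ord_vars n)" for i
    by auto
  have "card M = n"
    unfolding M_def card_image[OF inj] by simp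
  then have "card W = n + card (weakenings m n)"
    using disj fin by (simp add: W_def card_Un_disjoint finite_weakenings)
  moreover have "card (weakenings m n) + 2 * n = 2 ^ n"
    using card_weakenings[of m n] unfolding n by blast
  ultimately have "card W + n = 2 ^ n"
    by linarith
  then have "real (card W + n) = 2 ^ n"
    by simp
  then have card: "real (card W) = 2 ^ n - real n"
    by simp
  \<comment> \<open>The non-minimality axioms are the sources of \<open>{1..n}\<close>, so they sum
    to \<open>1 - sourceless {1..n}\<close>; the transitivity part supplies the rest.\<close>
  have "(\<Sum>w\<in>M. weakened_axiom n w) = (\<Sum>i\<in>{1..n}. source {1..n} i)"
    unfolding M_def sum.reindex[OF inj]
    by (simp add: weakened_axiom_def bmonom_poly_def source_def)
  moreover have "(\<Sum>w\<in>weakenings m n. weakened_axiom n w) = sourceless {1..n}"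
    using sum_weakenings_eq_sourceless[of m n n] n A by simp
  ultimately have "(\<Sum>w\<in>W. weakened_axiom n w) = 1"
    using disj fin by (simp add: W_def sum.union_disjoint finite_weakenings sourceless_def)
  then have "(\<Sum>i\<in>ord_indices n. ord_axiom n i * comb_poly (unit_coeffs W i)) = 1"
    by (simp add: sum_comb_poly_unit_coeffs fin finite_ord_indices idx weakened_axiom_def
        case_prod_unfold)
  moreover have "finite (ord_vars n)"
    using finite_up_pairs[of "{1..n}"] up_pairs_atLeastAtMost by simp
  \<comment> \<open>The identity is exact, so every Boolean axiom gets the multiplier 0.\<close>
  ultimately have
    "nullstellensatz_proof (ord_vars n) (ord_indices n) (ord_axiom n) (unit_coeffs W) (\<lambda>_. 0)"
    using mon by (simp add: nullstellensatz_proof_def finite_ord_indices keys_unit_coeffs fin vars_def)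
  moreover have "real (ns_size (ord_indices n) (unit_coeffs W)) = 2 ^ n - real n"
    using card by (simp add: ns_size_unit_coeffs fin idx)
  moreover have "ns_coeff_size (ord_indices n) (unit_coeffs W) = 2 ^ n - real n"
    using card by (simp add: ns_coeff_size_unit_coeffs fin idx finite_ord_indices)
  ultimately show ?thesis
    by blast
qed

end
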